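(* Let $T\subseteq\mathbb{R}$ be unbounded above and let $\{X_t : t \in T\}$ and $\{Y_t : t \in T\}$ be two real-valued stochastic processes. If $X_t \leq_{\mathcal{W}_2\text{-ast}} Y_t$, as $t \to \infty$, then $X_t \leq_{L_1\text{-ast}} Y_t$, as $t \to \infty$.
   Context: For a cdf $F$, $F^{\leftarrow}(u)=\inf\{x\in\mathbb{R}: F(x)\ge u\}$ for $u\in(0,1)$. $F_{X_t}$, $F_{Y_t}$ are the cdfs of $X_t,Y_t$. Limits as $t\to\infty$ are taken along $t\in T$. $\mathcal{W}_2$-asymptotic usual stochastic order: $X_t \leq_{\mathcal{W}_2\text{-ast}} Y_t$, as $t\to\infty$, means $\lim_{t\to\infty}\int_{A_{0,t}} (F_{X_t}^{\leftarrow}(u)-F_{Y_t}^{\leftarrow}(u))^2\,du=0$, where $A_{0,t}=\{u\in(0,1): F_{X_t}^{\leftarrow}(u)>F_{Y_t}^{\leftarrow}(u)\}$. $L_1$-asymptotic usual stochastic order: $X_t \leq_{L_1\text{-ast}} Y_t$, as $t\to\infty$, means $\lim_{t\to\infty}\int_{P_{0,t}} |F_{X_t}(x)-F_{Y_t}(x)|\,dx=0$, where $P_{0,t}=\{x\in\mathbb{R}: F_{X_t}(x)<F_{Y_t}(x)\}$. *)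

theory Defs
  imports "HOL-Probability.Probability"
begin

definition cdf_of :: "'a measure \<Rightarrow> ('a \<Rightarrow> real) \<Rightarrow> real \<Rightarrow> real" where
  "cdf_of M X = cdf (distr M borel X)"

text \<open>The left-continuous inverse; meaningful for arguments in the open unit interval, where for
  a cdf the set is nonempty and bounded below, so that the real infimum is the genuine one.\<close>

definition quantile :: "(real \<Rightarrow> real) \<Rightarrow> real \<Rightarrow> real" where
  "quantile F u = Inf {x. F x \<ge> u}"

text \<open>In the two asymptotic orders below, the integrands are nonnegative and no moment condition is
  imposed on the processes, so the integrals are taken with values in the extended
  nonnegative reals: an infinite integral counts as \<open>\<infinity>\<close> and not as \<open>0\<close>.
  The filter \<open>inf at_top (principal T)\<close> expresses that the argument tends to infinity along \<open>T\<close>.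
  The orders depend only on the marginal distributions, so the two processes may be defined on
  different probability spaces.\<close>

definition W2_ast ::
  "real set \<Rightarrow> 'a measure \<Rightarrow> (real \<Rightarrow> 'a \<Rightarrow> real) \<Rightarrow> 'b measure \<Rightarrow> (real \<Rightarrow> 'b \<Rightarrow> real) \<Rightarrow> bool" where
  "W2_ast T M X N Y \<longleftrightarrow>
     ((\<lambda>t. \<integral>\<^sup>+ u \<in> {u \<in> {0<..<1}. quantile (cdf_of M (X t)) u > quantile (cdf_of N (Y t)) u}.
             ennreal ((quantile (cdf_of M (X t)) u - quantile (cdf_of N (Y t)) u)\<^sup>2) \<partial>lborel)
        \<longlongrightarrow> 0) (inf at_top (principal T))"

definition L1_ast ::
  "real set \<Rightarrow> 'a measure \<Rightarrow> (real \<Rightarrow> 'a \<Rightarrow> real) \<Rightarrow> 'b measure \<Rightarrow> (real \<Rightarrow> 'b \<Rightarrow> real) \<Rightarrow> bool" where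
  "L1_ast T M X N Y \<longleftrightarrow>
     ((\<lambda>t. \<integral>\<^sup>+ x \<in> {x. cdf_of M (X t) x < cdf_of N (Y t) x}.
             ennreal \<bar>cdf_of M (X t) x - cdf_of N (Y t) x\<bar> \<partial>lborel)
        \<longlongrightarrow> 0) (inf at_top (principal T))"

end

theory Submission
  imports Defs
begin

text \<open>
  Write \<open>F\<close> and \<open>G\<close> for the two cdfs at a fixed time, and \<open>Q\<^sub>F\<close> and \<open>Q\<^sub>G\<close> for their left-continuous
  inverses.  For \<open>u\<close> in the open unit interval, \<open>Q\<^sub>F u \<le> x\<close> if and only if \<open>u \<le> F x\<close>.  Hence, for such
  \<open>u\<close>, the region \<open>{(x, u). F x < u \<and> u \<le> G x}\<close> between the two graphs is the same as
  \<open>{(x, u). Q\<^sub>G u \<le> x \<and> x < Q\<^sub>F u}\<close>.  Its vertical sections have length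
  \<open>(G x - F x)\<^sup>+\<close> and its horizontal sections have length \<open>(Q\<^sub>F u - Q\<^sub>G u)\<^sup>+\<close>, so Tonelli's theorem
  equates the \<open>L\<^sub>1\<close> functional of the conclusion with the first moment of \<open>(Q\<^sub>F - Q\<^sub>G)\<^sup>+\<close>
  (lemma \<open>nn_integral_cdf_excess_eq_quantile_excess\<close>).

  The hypothesis concerns the second moment of the same function.  The parameter \<open>u\<close> ranges over a
  probability space, the unit interval, so by Cauchy--Schwarz the square of the first moment is at
  most the second (lemma \<open>cdf_excess_squared_le\<close>).  The bound holds at every time and has no
  constant depending on the distributions, and hence convergence to zero carries over.
\<close>

text \<open>The quantile variable lives on the open unit interval, where the left-continuous inverse is
  a genuine infimum and the Galois connection with the cdf holds.\<close>

abbreviation unit_interval :: "real measure" where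
  "unit_interval \<equiv> restrict_space lborel {0<..<1}"

lemma prob_space_unit_interval: "prob_space unit_interval"
  by (auto simp: emeasure_restrict_space space_restrict_space intro!: prob_spaceI)

lemma quantile_le_iff:
  assumes "real_distribution A" "0 < u" "u < 1"
  shows "quantile (cdf A) u \<le> x \<longleftrightarrow> u \<le> cdf A x"
proof -
  interpret cdf_distribution A
    using assms(1) by (simp add: cdf_distribution_def)
  show ?thesis
    unfolding quantile_def by (rule pseudoinverse[OF assms(2,3), symmetric])
qed

lemma borel_measurable_cdf:
  assumes "real_distribution A"
  shows "cdf A \<in> borel_measurable borel"
proof -
  interpret cdf_distribution A
    using assms by (simp add: cdf_distribution_def)
  show ?thesis by (rule measurable_C)
qed

lemma borel_measurable_quantile:
  assumes "real_distribution A"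
  shows "quantile (cdf A) \<in> borel_measurable unit_interval"
proof -
  interpret cdf_distribution A
    using assms by (simp add: cdf_distribution_def)
  have "sets unit_interval = sets (restrict_space borel {0<..<1})"
    by (simp add: sets_restrict_space)
  then show ?thesis
    using measurable_CI by (simp add: quantile_def[abs_def] cong: measurable_cong_sets)
qed

text \<open>At \<open>u = 1\<close>, which may be a value of a cdf, the open unit interval misses a point of the
  section; sandwiching between an open and a half-open interval shows that this costs no length.\<close>

lemma emeasure_unit_interval_greaterThanAtMost:
  assumes "0 \<le> a" "b \<le> 1"
  shows "emeasure unit_interval {u \<in> {0<..<1}. a < u \<and> u \<le> b} = ennreal (b - a)"
proof -
  let ?S = "{u \<in> {0<..<1}. a < u \<and> u \<le> b}"
  have "emeasure lborel {a<..<b} = ennreal (b - a)" "emeasure lborel {a<..b} = ennreal (b - a)"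
    by (cases "a \<le> b"; simp add: ennreal_neg)+
  moreover have "emeasure lborel {a<..<b} \<le> emeasure lborel ?S"
    using assms by (intro emeasure_mono) auto
  moreover have "emeasure lborel ?S \<le> emeasure lborel {a<..b}"
    by (intro emeasure_mono) auto
  ultimately have "emeasure lborel ?S = ennreal (b - a)"
    by (metis antisym)
  then show ?thesis
    by (subst emeasure_restrict_space) auto
qed

text \<open>Both sides are the area of the region between the two graphs, sliced once vertically and once
  horizontally.  The truncation at zero is performed by the coercion into the extended nonnegative
  reals.\<close>

lemma nn_integral_cdf_excess_eq_quantile_excess:
  assumes A: "real_distribution A" and B: "real_distribution B"
  shows "(\<integral>\<^sup>+ x. ennreal (cdf B x - cdf A x) \<partial>lborel) =
         (\<integral>\<^sup>+ u. ennreal (quantile (cdf A) u - quantile (cdf B) u) \<partial>unit_interval)"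
proof -
  interpret A: real_distribution A by (rule A)
  interpret B: real_distribution B by (rule B)
  interpret U: prob_space unit_interval by (rule prob_space_unit_interval)
  interpret pair_sigma_finite lborel unit_interval ..
  have [measurable]: "cdf A \<in> borel_measurable borel" "cdf B \<in> borel_measurable borel"
    using A B by (auto intro: borel_measurable_cdf)
  have [measurable]: "(\<lambda>u. u) \<in> borel_measurable unit_interval"
    by (intro measurable_restrict_space1) simp
  define h :: "real \<Rightarrow> real \<Rightarrow> ennreal"
    where "h x u = (if cdf A x < u \<and> u \<le> cdf B x then 1 else 0)" for x u
  have vertical: "(\<integral>\<^sup>+ u. h x u \<partial>unit_interval) = ennreal (cdf B x - cdf A x)" for x
  proof -
    have "(\<integral>\<^sup>+ u. h x u \<partial>unit_interval) =
        (\<integral>\<^sup>+ u. indicator {u \<in> {0<..<1}. cdf A x < u \<and> u \<le> cdf B x} u \<partial>unit_interval)"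
      by (intro nn_integral_cong) (auto simp: h_def space_restrict_space)
    also have "\<dots> = emeasure unit_interval {u \<in> {0<..<1}. cdf A x < u \<and> u \<le> cdf B x}"
      by (intro nn_integral_indicator) (auto simp: sets_restrict_space_iff)
    finally show ?thesis
      using emeasure_unit_interval_greaterThanAtMost[OF A.cdf_nonneg B.cdf_bounded_prob] by simp
  qed
  have horizontal:
    "(\<integral>\<^sup>+ x. h x u \<partial>lborel) = ennreal (quantile (cdf A) u - quantile (cdf B) u)"
    if "u \<in> space unit_interval" for u
  proof -
    have u: "0 < u" "u < 1"
      using that by (auto simp: space_restrict_space)
    have "cdf A x < u \<longleftrightarrow> x < quantile (cdf A) u" "u \<le> cdf B x \<longleftrightarrow> quantile (cdf B) u \<le> x" for x
      using quantile_le_iff[OF A u, of x] quantile_le_iff[OF B u, of x] by linarith+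
    then have "(\<integral>\<^sup>+ x. h x u \<partial>lborel) =
        (\<integral>\<^sup>+ x. indicator {quantile (cdf B) u ..< quantile (cdf A) u} x \<partial>lborel)"
      by (intro nn_integral_cong) (auto simp: h_def indicator_def)
    also have "\<dots> = ennreal (quantile (cdf A) u - quantile (cdf B) u)"
      by (cases "quantile (cdf B) u \<le> quantile (cdf A) u") (auto simp: ennreal_neg)
    finally show ?thesis .
  qed
  have "(\<integral>\<^sup>+ x. ennreal (cdf B x - cdf A x) \<partial>lborel) = (\<integral>\<^sup>+ x. \<integral>\<^sup>+ u. h x u \<partial>unit_interval \<partial>lborel)"
    by (simp add: vertical)
  also have "\<dots> = (\<integral>\<^sup>+ u. \<integral>\<^sup>+ x. h x u \<partial>lborel \<partial>unit_interval)"
    by (intro Fubini'[symmetric]) (simp add: h_def case_prod_beta')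
  also have "\<dots> = (\<integral>\<^sup>+ u. ennreal (quantile (cdf A) u - quantile (cdf B) u) \<partial>unit_interval)"
    by (intro nn_integral_cong horizontal)
  finally show ?thesis .
qed

lemma (in prob_space) nn_integral_squared_le:
  assumes "f \<in> borel_measurable M"
  shows "(\<integral>\<^sup>+ x. f x \<partial>M)\<^sup>2 \<le> (\<integral>\<^sup>+ x. (f x)\<^sup>2 \<partial>M)"
  using Cauchy_Schwarz_nn_integral[OF assms, of "\<lambda>_. 1"] by (simp add: emeasure_space_1)

lemma cdf_excess_squared_le:
  assumes A: "real_distribution A" and B: "real_distribution B"
  shows "(\<integral>\<^sup>+ x \<in> {x. cdf A x < cdf B x}. ennreal \<bar>cdf A x - cdf B x\<bar> \<partial>lborel)\<^sup>2 \<le>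
         (\<integral>\<^sup>+ u \<in> {u \<in> {0<..<1}. quantile (cdf A) u > quantile (cdf B) u}.
            ennreal ((quantile (cdf A) u - quantile (cdf B) u)\<^sup>2) \<partial>lborel)"
proof -
  interpret U: prob_space unit_interval by (rule prob_space_unit_interval)
  let ?d = "\<lambda>u. quantile (cdf A) u - quantile (cdf B) u"
  have "(\<integral>\<^sup>+ x \<in> {x. cdf A x < cdf B x}. ennreal \<bar>cdf A x - cdf B x\<bar> \<partial>lborel) =
      (\<integral>\<^sup>+ x. ennreal (cdf B x - cdf A x) \<partial>lborel)"
    by (intro nn_integral_cong) (auto simp: indicator_def ennreal_neg)
  also have "\<dots> = (\<integral>\<^sup>+ u. ennreal (?d u) \<partial>unit_interval)"
    by (rule nn_integral_cdf_excess_eq_quantile_excess[OF A B])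
  also have "\<dots>\<^sup>2 \<le> (\<integral>\<^sup>+ u. (ennreal (?d u))\<^sup>2 \<partial>unit_interval)"
    using A B by (intro U.nn_integral_squared_le measurable_compose[OF _ measurable_ennreal]
        borel_measurable_diff borel_measurable_quantile)
  also have "\<dots> = (\<integral>\<^sup>+ u \<in> {0<..<1}. (ennreal (?d u))\<^sup>2 \<partial>lborel)"
    by (intro nn_integral_restrict_space) simp
  also have "\<dots> = (\<integral>\<^sup>+ u \<in> {u \<in> {0<..<1}. quantile (cdf A) u > quantile (cdf B) u}.
      ennreal ((?d u)\<^sup>2) \<partial>lborel)"
    by (intro nn_integral_cong) (auto simp: indicator_def ennreal_neg ennreal_power)
  finally show ?thesis .
qed

lemma tendsto_zero_of_squared_le_ennreal:
  fixes f g :: "'a \<Rightarrow> ennreal"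
  assumes g: "(g \<longlongrightarrow> 0) \<F>" and le: "\<forall>\<^sub>F t in \<F>. (f t)\<^sup>2 \<le> g t"
  shows "(f \<longlongrightarrow> 0) \<F>"
proof (rule order_tendstoI)
  fix e :: ennreal assume "0 < e"
  then have "0 < e\<^sup>2"
    by (simp add: power2_eq_square ennreal_zero_less_mult_iff)
  from order_tendstoD(2)[OF g this] le show "\<forall>\<^sub>F t in \<F>. f t < e"
  proof eventually_elim
    case (elim t)
    then have "(f t)\<^sup>2 < e\<^sup>2" by simp
    then show ?case
      by (meson not_le power_mono zero_le)
  qed
qed simp

theorem theorem6p2:
  fixes T :: "real set"
    and M :: "'a measure" and X :: "real \<Rightarrow> 'a \<Rightarrow> real"
    and N :: "'b measure" and Y :: "real \<Rightarrow> 'b \<Rightarrow> real"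
  assumes "\<not> bdd_above T"
    and "prob_space M" and "prob_space N"
    and "\<And>t. t \<in> T \<Longrightarrow> X t \<in> borel_measurable M"
    and "\<And>t. t \<in> T \<Longrightarrow> Y t \<in> borel_measurable N"
    and "W2_ast T M X N Y"
  shows "L1_ast T M X N Y"
proof -
  have "real_distribution (distr M borel (X t))" "real_distribution (distr N borel (Y t))"
    if "t \<in> T" for t
    using assms(2-5) that by (auto intro!: prob_space.real_distribution_distr)
  then have "\<forall>\<^sub>F t in inf at_top (principal T).
      (\<integral>\<^sup>+ x \<in> {x. cdf_of M (X t) x < cdf_of N (Y t) x}.
         ennreal \<bar>cdf_of M (X t) x - cdf_of N (Y t) x\<bar> \<partial>lborel)\<^sup>2 \<le>
      (\<integral>\<^sup>+ u \<in> {u \<in> {0<..<1}. quantile (cdf_of M (X t)) u > quantile (cdf_of N (Y t)) u}.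
         ennreal ((quantile (cdf_of M (X t)) u - quantile (cdf_of N (Y t)) u)\<^sup>2) \<partial>lborel)"
    unfolding cdf_of_def eventually_inf_principal
    by (intro always_eventually allI impI cdf_excess_squared_le)
  with assms(6) show ?thesis
    unfolding L1_ast_def W2_ast_def by (rule tendsto_zero_of_squared_le_ennreal)
qed

end
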